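(* Let $(X,\mathcal{E})$ be a coarse space and $\lambda$ the asymptotic resemblance induced by $\mathcal{E}$. Then the following are equivalent: (i) $(X,\mathcal{E})$ is coarsely normal; (ii) $(X,\lambda)$ is asymptotically normal.
   Context: A coarse structure on a set $X$ is a collection $\mathcal{E}$ of subsets of $X\times X$ (called controlled sets or entourages) that contains the diagonal $\triangle=\{(x,x)\mid x\in X\}$ and is closed under taking subsets, inverses $E^{-1}=\{(x,y)\mid (y,x)\in E\}$, finite unions, and compositions $E\circ F=\{(x,y)\mid \exists z\in X,\ (x,z)\in E,\ (z,y)\in F\}$. The pair $(X,\mathcal{E})$ is a coarse space. For $A\subseteq X$ and $E\in\mathcal{E}$, $E[A]=\{x\in X\mid \exists a\in A,\ (x,a)\in E\}$. A subset $A\subseteq X$ is (coarsely) bounded if $A\times A\in\mathcal{E}$. For $A,B\subseteq X$, $A\prec B$ means that for every $E\in\mathcal{E}$ there is a (coarsely) bounded set $K\subseteq X$ with $E[A]\subseteq B\cup K$. $(X,\mathcal{E})$ is coarsely normal if for all $A,B\subseteq X$ with $A\prec B$ there is $C\subseteq X$ with $A\prec C\prec B$. An asymptotic resemblance on $X$ is an equivalence relation $\lambda$ on the power set of $X$ such that: (a) $A_1\lambda B_1$ and $A_2\lambda B_2$ imply $(A_1\cup A_2)\lambda(B_1\cup B_2)$; (b) $(B_1\cup B_2)\lambda A$ with $B_1,B_2\neq\emptyset$ implies that there are nonempty $A_1,A_2\subseteq A$ with $A=A_1\cup A_2$, $B_1\lambda A_1$, $B_2\lambda A_2$. The asymptotic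 resemblance induced by $\mathcal{E}$ is: $A\lambda B$ if and only if there is $E\in\mathcal{E}$ with $A\subseteq E[B]$ and $B\subseteq E[A]$. In an asymptotic resemblance space $(X,\lambda)$, a set $A\subseteq X$ is (asymptotically) bounded if $A=\emptyset$ or $A\lambda\{x\}$ for some $x\in X$, and (asymptotically) unbounded otherwise. Subsets $A,C\subseteq X$ are asymptotically disjoint if for all asymptotically unbounded $A'\subseteq A$ and $C'\subseteq C$, $A'\lambda C'$ does not hold. $(X,\lambda)$ is asymptotically normal if for all asymptotically disjoint $A_1,A_2\subseteq X$ there are $X_1,X_2\subseteq X$ with $X=X_1\cup X_2$, $A_1$ asymptotically disjoint from $X_1$, and $A_2$ asymptotically disjoint from $X_2$. *)

theory Defs
  imports Main
begin

text \<open>The library's relational composition \<open>E O F\<close> is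
  \<open>{(x, y). \<exists>z. (x, z) \<in> E \<and> (z, y) \<in> F}\<close>, the composition used here. Coarse spaces are not
  assumed connected, so a finite union of bounded sets need not be bounded.\<close>

locale coarse_space =
  fixes X :: "'a set" and \<E> :: "('a \<times> 'a) set set"
  assumes controlled_subset: "E \<in> \<E> \<Longrightarrow> E \<subseteq> X \<times> X"
    and diagonal: "Id_on X \<in> \<E>"
    and subset_closed: "E \<in> \<E> \<Longrightarrow> F \<subseteq> E \<Longrightarrow> F \<in> \<E>"
    and inverse_closed: "E \<in> \<E> \<Longrightarrow> E\<inverse> \<in> \<E>"
    and union_closed: "E \<in> \<E> \<Longrightarrow> F \<in> \<E> \<Longrightarrow> E \<union> F \<in> \<E>"
    and comp_closed: "E \<in> \<E> \<Longrightarrow> F \<in> \<E> \<Longrightarrow> E O F \<in> \<E>"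

text \<open>\<open>E[A]\<close> collects first components, so it is \<open>E\<inverse> `` A\<close> rather than \<open>E `` A\<close>.\<close>

definition nbhd :: "'a set \<Rightarrow> ('a \<times> 'a) set \<Rightarrow> 'a set \<Rightarrow> 'a set" where
  "nbhd X E A = {x \<in> X. \<exists>a\<in>A. (x, a) \<in> E}"

definition coarsely_bounded :: "'a set \<Rightarrow> ('a \<times> 'a) set set \<Rightarrow> 'a set \<Rightarrow> bool" where
  "coarsely_bounded X \<E> A \<longleftrightarrow> A \<subseteq> X \<and> A \<times> A \<in> \<E>"

definition coarse_prec :: "'a set \<Rightarrow> ('a \<times> 'a) set set \<Rightarrow> 'a set \<Rightarrow> 'a set \<Rightarrow> bool" where
  "coarse_prec X \<E> A B \<longleftrightarrow> (\<forall>E\<in>\<E>. \<exists>K. coarsely_bounded X \<E> K \<and> nbhd X E A \<subseteq> B \<union> K)"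

definition coarsely_normal :: "'a set \<Rightarrow> ('a \<times> 'a) set set \<Rightarrow> bool" where
  "coarsely_normal X \<E> \<longleftrightarrow>
    (\<forall>A B. A \<subseteq> X \<longrightarrow> B \<subseteq> X \<longrightarrow> coarse_prec X \<E> A B \<longrightarrow>
      (\<exists>C. C \<subseteq> X \<and> coarse_prec X \<E> A C \<and> coarse_prec X \<E> C B))"

locale asymptotic_resemblance =
  fixes X :: "'a set" and R :: "('a set \<times> 'a set) set"
  assumes equiv_Pow: "equiv (Pow X) R"
    and union_compat: "(A1, B1) \<in> R \<Longrightarrow> (A2, B2) \<in> R \<Longrightarrow> (A1 \<union> A2, B1 \<union> B2) \<in> R"
    and union_split: "(B1 \<union> B2, A) \<in> R \<Longrightarrow> B1 \<noteq> {} \<Longrightarrow> B2 \<noteq> {} \<Longrightarrow>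
      \<exists>A1 A2. A1 \<noteq> {} \<and> A2 \<noteq> {} \<and> A = A1 \<union> A2 \<and> (B1, A1) \<in> R \<and> (B2, A2) \<in> R"

definition induced_resemblance ::
    "'a set \<Rightarrow> ('a \<times> 'a) set set \<Rightarrow> ('a set \<times> 'a set) set" where
  "induced_resemblance X \<E> =
    {(A, B). A \<subseteq> X \<and> B \<subseteq> X \<and> (\<exists>E\<in>\<E>. A \<subseteq> nbhd X E B \<and> B \<subseteq> nbhd X E A)}"

definition asymptotically_bounded ::
    "'a set \<Rightarrow> ('a set \<times> 'a set) set \<Rightarrow> 'a set \<Rightarrow> bool" where
  "asymptotically_bounded X R A \<longleftrightarrow> A = {} \<or> (\<exists>x\<in>X. (A, {x}) \<in> R)"

definition asymptotically_disjoint ::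
    "'a set \<Rightarrow> ('a set \<times> 'a set) set \<Rightarrow> 'a set \<Rightarrow> 'a set \<Rightarrow> bool" where
  "asymptotically_disjoint X R A C \<longleftrightarrow>
    (\<forall>A' C'. A' \<subseteq> A \<longrightarrow> C' \<subseteq> C \<longrightarrow>
      \<not> asymptotically_bounded X R A' \<longrightarrow> \<not> asymptotically_bounded X R C' \<longrightarrow>
      (A', C') \<notin> R)"

definition asymptotically_normal :: "'a set \<Rightarrow> ('a set \<times> 'a set) set \<Rightarrow> bool" where
  "asymptotically_normal X R \<longleftrightarrow>
    (\<forall>A1 A2. A1 \<subseteq> X \<longrightarrow> A2 \<subseteq> X \<longrightarrow> asymptotically_disjoint X R A1 A2 \<longrightarrow>
      (\<exists>X1 X2. X1 \<subseteq> X \<and> X2 \<subseteq> X \<and> X = X1 \<union> X2 \<and>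
        asymptotically_disjoint X R A1 X1 \<and> asymptotically_disjoint X R A2 X2))"

lemma nbhd_mono: "E \<subseteq> F \<Longrightarrow> A \<subseteq> B \<Longrightarrow> nbhd X E A \<subseteq> nbhd X F B"
  by (auto simp: nbhd_def)

lemma nbhd_nbhd: "nbhd X E (nbhd X F A) \<subseteq> nbhd X (E O F) A"
  by (auto simp: nbhd_def)

lemma (in coarse_space) asymptotic_resemblance_induced:
  "asymptotic_resemblance X (induced_resemblance X \<E>)"
proof
  let ?L = "induced_resemblance X \<E>"
  show "equiv (Pow X) ?L"
  proof (rule equivI)
    show "?L \<subseteq> Pow X \<times> Pow X"
      by (auto simp: induced_resemblance_def)
    show "refl_on (Pow X) ?L"
    proof (rule refl_onI)
      fix A assume "A \<in> Pow X"
      then have "A \<subseteq> nbhd X (Id_on X) A"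
        by (auto simp: nbhd_def)
      with \<open>A \<in> Pow X\<close> diagonal show "(A, A) \<in> ?L"
        unfolding induced_resemblance_def by blast
    qed
    show "sym ?L"
      by (rule symI) (auto simp: induced_resemblance_def)
    show "trans ?L"
    proof (rule transI)
      fix A B C assume "(A, B) \<in> ?L" "(B, C) \<in> ?L"
      then obtain E F where E: "E \<in> \<E>" "A \<subseteq> nbhd X E B" "B \<subseteq> nbhd X E A"
        and F: "F \<in> \<E>" "B \<subseteq> nbhd X F C" "C \<subseteq> nbhd X F B" and sub: "A \<subseteq> X" "C \<subseteq> X"
        unfolding induced_resemblance_def by blast
      have "A \<subseteq> nbhd X (E O F) C"
        using E(2) nbhd_mono[OF order_refl F(2)] nbhd_nbhd by (rule order_trans[OF order_trans])
      moreover have "C \<subseteq> nbhd X (F O E) A"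
        using F(3) nbhd_mono[OF order_refl E(3)] nbhd_nbhd by (rule order_trans[OF order_trans])
      ultimately have "A \<subseteq> nbhd X (E O F \<union> F O E) C" "C \<subseteq> nbhd X (E O F \<union> F O E) A"
        using nbhd_mono[OF Un_upper1 order_refl] nbhd_mono[OF Un_upper2 order_refl]
        by (meson order_trans)+
      moreover have "E O F \<union> F O E \<in> \<E>"
        using E F by (intro union_closed comp_closed)
      ultimately show "(A, C) \<in> ?L"
        using sub unfolding induced_resemblance_def by blast
    qed
  qed
next
  fix A1 B1 A2 B2
  assume "(A1, B1) \<in> induced_resemblance X \<E>" "(A2, B2) \<in> induced_resemblance X \<E>"
  then obtain E F where E: "E \<in> \<E>" "A1 \<subseteq> nbhd X E B1" "B1 \<subseteq> nbhd X E A1"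
    and F: "F \<in> \<E>" "A2 \<subseteq> nbhd X F B2" "B2 \<subseteq> nbhd X F A2"
    and sub: "A1 \<union> A2 \<subseteq> X" "B1 \<union> B2 \<subseteq> X"
    unfolding induced_resemblance_def by blast
  have "A1 \<union> A2 \<subseteq> nbhd X (E \<union> F) (B1 \<union> B2)" "B1 \<union> B2 \<subseteq> nbhd X (E \<union> F) (A1 \<union> A2)"
    using E(2,3) F(2,3) nbhd_mono[OF Un_upper1 Un_upper1] nbhd_mono[OF Un_upper2 Un_upper2]
    by (meson Un_least order_trans)+
  with sub union_closed[OF E(1) F(1)]
  show "(A1 \<union> A2, B1 \<union> B2) \<in> induced_resemblance X \<E>"
    unfolding induced_resemblance_def by blast
next
  fix B1 B2 A :: "'a set"
  assume "(B1 \<union> B2, A) \<in> induced_resemblance X \<E>" and ne: "B1 \<noteq> {}" "B2 \<noteq> {}"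
  then obtain E where E: "E \<in> \<E>" "B1 \<union> B2 \<subseteq> nbhd X E A" "A \<subseteq> nbhd X E (B1 \<union> B2)"
    and sub: "B1 \<subseteq> X" "B2 \<subseteq> X" "A \<subseteq> X"
    unfolding induced_resemblance_def by blast
  define F where "F = E \<union> E\<inverse>"
  have F: "F \<in> \<E>"
    unfolding F_def using E(1) by (intro union_closed inverse_closed)
  have *: "(B, A \<inter> nbhd X F B) \<in> induced_resemblance X \<E> \<and> A \<inter> nbhd X F B \<noteq> {}"
    if B: "B \<subseteq> B1 \<union> B2" "B \<noteq> {}" for B
  proof -
    have "B \<subseteq> nbhd X F (A \<inter> nbhd X F B)"
    proof
      fix b assume "b \<in> B"
      with E(2) B(1) have "b \<in> nbhd X E A"
        by blast
      then obtain a where "b \<in> X" "a \<in> A" "(b, a) \<in> E"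
        by (auto simp: nbhd_def)
      with sub \<open>b \<in> B\<close> have "a \<in> A \<inter> nbhd X F B" "(b, a) \<in> F"
        by (auto simp: nbhd_def F_def)
      with \<open>b \<in> X\<close> show "b \<in> nbhd X F (A \<inter> nbhd X F B)"
        unfolding nbhd_def[of X F "A \<inter> _"] by blast
    qed
    moreover from this B(2) have "A \<inter> nbhd X F B \<noteq> {}"
      by (auto simp: nbhd_def)
    ultimately show ?thesis
      using F B(1) sub unfolding induced_resemblance_def by blast
  qed
  have "A = (A \<inter> nbhd X F B1) \<union> (A \<inter> nbhd X F B2)"
    using E(3) by (auto simp: F_def nbhd_def)
  moreover note *[OF Un_upper1 ne(1)] *[OF Un_upper2 ne(2)]
  ultimately show "\<exists>A1 A2. A1 \<noteq> {} \<and> A2 \<noteq> {} \<and> A = A1 \<union> A2 \<and>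
      (B1, A1) \<in> induced_resemblance X \<E> \<and> (B2, A2) \<in> induced_resemblance X \<E>"
    by (intro exI[of _ "A \<inter> nbhd X F B1"] exI[of _ "A \<inter> nbhd X F B2"]) simp
qed

end

theory Submission
  imports Defs
begin

text \<open>
  The two normality conditions are the same condition, read through the equivalence
  \<open>A \<prec> B\<close> if and only if \<open>A\<close> is asymptotically disjoint from \<open>X - B\<close>
  (\<open>coarse_prec_iff_asymptotically_disjoint\<close>). An interpolant \<open>A \<prec> C \<prec> B\<close> then corresponds to
  the cover of \<open>X\<close> by \<open>X - C\<close> and \<open>C\<close>, the first asymptotically disjoint from \<open>A\<close> and the second
  from \<open>X - B\<close>.

  For the equivalence, note first that the coarsely bounded sets are the asymptotically bounded
  ones, and that boundedness is invariant under \<open>\<lambda>\<close>. If \<open>A \<prec> B\<close>, then any subset of \<open>X - B\<close>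
  that resembles a subset of \<open>A\<close> lies in some \<open>E[A] - B\<close> and so is bounded. Conversely, for a
  controlled set \<open>E\<close> the set \<open>E[A] - B\<close> resembles the set of those points of \<open>A\<close> that witness
  membership in it; if \<open>A\<close> is asymptotically disjoint from \<open>X - B\<close>, one of these two sets is
  bounded, hence so is the other, and \<open>E[A] - B\<close> serves as the exceptional bounded set. No step
  uses connectedness of the coarse structure.
\<close>

lemma asymptotically_disjoint_mono:
  assumes "asymptotically_disjoint X R A C" "A' \<subseteq> A" "C' \<subseteq> C"
  shows "asymptotically_disjoint X R A' C'"
  unfolding asymptotically_disjoint_def
proof (intro allI impI)
  fix A'' C''
  assume "A'' \<subseteq> A'" "C'' \<subseteq> C'"
    and "\<not> asymptotically_bounded X R A''" "\<not> asymptotically_bounded X R C''"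
  with assms show "(A'', C'') \<notin> R"
    unfolding asymptotically_disjoint_def by (metis order_trans)
qed

lemma induced_resemblance_sym:
  "(A, B) \<in> induced_resemblance X \<E> \<Longrightarrow> (B, A) \<in> induced_resemblance X \<E>"
  by (auto simp: induced_resemblance_def)

lemma asymptotically_disjoint_induced_sym:
  "asymptotically_disjoint X (induced_resemblance X \<E>) A C \<Longrightarrow>
    asymptotically_disjoint X (induced_resemblance X \<E>) C A"
  unfolding asymptotically_disjoint_def using induced_resemblance_sym by blast

context coarse_space
begin

lemma induced_resemblance_trans:
  assumes "(A, B) \<in> induced_resemblance X \<E>" "(B, C) \<in> induced_resemblance X \<E>"
  shows "(A, C) \<in> induced_resemblance X \<E>"
  using asymptotic_resemblance.equiv_Pow[OF asymptotic_resemblance_induced]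
  by (elim equivE) (rule transD[OF _ assms])

lemma coarsely_bounded_iff_asymptotically_bounded:
  assumes "A \<subseteq> X"
  shows "coarsely_bounded X \<E> A \<longleftrightarrow> asymptotically_bounded X (induced_resemblance X \<E>) A"
proof
  assume "coarsely_bounded X \<E> A"
  then have AA: "A \<times> A \<in> \<E>"
    by (simp add: coarsely_bounded_def)
  show "asymptotically_bounded X (induced_resemblance X \<E>) A"
  proof (cases "A = {}")
    case True
    then show ?thesis
      by (simp add: asymptotically_bounded_def)
  next
    case False
    then obtain x where x: "x \<in> A"
      by blast
    then have "A \<subseteq> nbhd X (A \<times> A) {x}" "{x} \<subseteq> nbhd X (A \<times> A) A"
      using assms by (auto simp: nbhd_def)
    then have "(A, {x}) \<in> induced_resemblance X \<E>"
      using AA x assms unfolding induced_resemblance_def by blast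
    then show ?thesis
      using x assms unfolding asymptotically_bounded_def by blast
  qed
next
  assume "asymptotically_bounded X (induced_resemblance X \<E>) A"
  then consider "A = {}" | x where "(A, {x}) \<in> induced_resemblance X \<E>"
    unfolding asymptotically_bounded_def by blast
  then show "coarsely_bounded X \<E> A"
  proof cases
    case 1
    have "{} \<in> \<E>"
      using subset_closed[OF diagonal] by blast
    with 1 show ?thesis
      by (simp add: coarsely_bounded_def)
  next
    case 2
    then obtain E where E: "E \<in> \<E>" "A \<subseteq> nbhd X E {x}"
      unfolding induced_resemblance_def by blast
    have "A \<times> A \<subseteq> E O E\<inverse>"
      using E(2) by (auto simp: nbhd_def)
    then show ?thesis
      using subset_closed[OF comp_closed[OF E(1) inverse_closed[OF E(1)]]] assms
      by (simp add: coarsely_bounded_def)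
  qed
qed

lemma asymptotically_bounded_resembling:
  assumes "(A, B) \<in> induced_resemblance X \<E>"
    and "asymptotically_bounded X (induced_resemblance X \<E>) A"
  shows "asymptotically_bounded X (induced_resemblance X \<E>) B"
proof (cases "A = {}")
  case True
  then have "B = {}"
    using assms(1) by (auto simp: induced_resemblance_def nbhd_def)
  then show ?thesis
    by (simp add: asymptotically_bounded_def)
next
  case False
  then obtain x where x: "x \<in> X" "(A, {x}) \<in> induced_resemblance X \<E>"
    using assms(2) unfolding asymptotically_bounded_def by blast
  have "(B, {x}) \<in> induced_resemblance X \<E>"
    using induced_resemblance_trans[OF induced_resemblance_sym[OF assms(1)] x(2)] .
  with x(1) show ?thesis
    unfolding asymptotically_bounded_def by blast
qed

lemma coarse_prec_iff_asymptotically_disjoint: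
  assumes "A \<subseteq> X"
  shows "coarse_prec X \<E> A B \<longleftrightarrow>
    asymptotically_disjoint X (induced_resemblance X \<E>) A (X - B)"
proof
  assume prec: "coarse_prec X \<E> A B"
  show "asymptotically_disjoint X (induced_resemblance X \<E>) A (X - B)"
    unfolding asymptotically_disjoint_def
  proof (intro allI impI notI)
    fix A' C'
    assume sub: "A' \<subseteq> A" "C' \<subseteq> X - B"
      and unbounded: "\<not> asymptotically_bounded X (induced_resemblance X \<E>) C'"
      and "(A', C') \<in> induced_resemblance X \<E>"
    then obtain E where E: "E \<in> \<E>" "C' \<subseteq> nbhd X E A'"
      unfolding induced_resemblance_def by blast
    obtain K where K: "coarsely_bounded X \<E> K" "nbhd X E A \<subseteq> B \<union> K"
      using prec E(1) unfolding coarse_prec_def by blast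
    have "C' \<subseteq> K"
      using E(2) nbhd_mono[OF order_refl sub(1)] K(2) sub(2) by blast
    then have "coarsely_bounded X \<E> C'"
      using K(1) subset_closed[of "K \<times> K" "C' \<times> C'"] by (auto simp: coarsely_bounded_def)
    then show False
      using unbounded coarsely_bounded_iff_asymptotically_bounded sub(2) by blast
  qed
next
  assume disj: "asymptotically_disjoint X (induced_resemblance X \<E>) A (X - B)"
  show "coarse_prec X \<E> A B"
    unfolding coarse_prec_def
  proof
    fix E assume E: "E \<in> \<E>"
    define C' where "C' = nbhd X E A - B"
    define A' where "A' = {a \<in> A. \<exists>c\<in>C'. (c, a) \<in> E}"
    have sub: "A' \<subseteq> A" "C' \<subseteq> X - B"
      by (auto simp: A'_def C'_def nbhd_def)
    have "A' \<subseteq> nbhd X (E \<union> E\<inverse>) C'" "C' \<subseteq> nbhd X (E \<union> E\<inverse>) A'"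
      using assms by (auto simp: A'_def C'_def nbhd_def)
    moreover have "E \<union> E\<inverse> \<in> \<E>"
      using E by (intro union_closed inverse_closed)
    ultimately have res: "(A', C') \<in> induced_resemblance X \<E>"
      using sub assms unfolding induced_resemblance_def by blast
    then have "asymptotically_bounded X (induced_resemblance X \<E>) C'"
      using disj sub asymptotically_bounded_resembling[OF res]
      unfolding asymptotically_disjoint_def by blast
    then have "coarsely_bounded X \<E> C'"
      using coarsely_bounded_iff_asymptotically_bounded sub(2) by blast
    moreover have "nbhd X E A \<subseteq> B \<union> C'"
      by (auto simp: C'_def)
    ultimately show "\<exists>K. coarsely_bounded X \<E> K \<and> nbhd X E A \<subseteq> B \<union> K"
      by blast
  qed
qed

end

theorem proposition3p23:
  fixes X :: "'a set" and \<E> :: "('a \<times> 'a) set set"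
  assumes "coarse_space X \<E>"
  shows "coarsely_normal X \<E> \<longleftrightarrow> asymptotically_normal X (induced_resemblance X \<E>)"
proof -
  interpret coarse_space X \<E>
    by (rule assms)
  let ?disj = "asymptotically_disjoint X (induced_resemblance X \<E>)"
  note prec_iff = coarse_prec_iff_asymptotically_disjoint
  show ?thesis
  proof
    assume normal: "coarsely_normal X \<E>"
    show "asymptotically_normal X (induced_resemblance X \<E>)"
      unfolding asymptotically_normal_def
    proof (intro allI impI)
      fix A1 A2 assume sub: "A1 \<subseteq> X" "A2 \<subseteq> X" and "?disj A1 A2"
      then have "coarse_prec X \<E> A1 (X - A2)"
        by (simp add: prec_iff double_diff)
      then obtain C where C: "C \<subseteq> X" "coarse_prec X \<E> A1 C" "coarse_prec X \<E> C (X - A2)"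
        using normal[unfolded coarsely_normal_def, rule_format, OF sub(1) Diff_subset] by blast
      have "?disj A1 (X - C)"
        using C(2) sub(1) by (simp add: prec_iff)
      moreover have "?disj C A2"
        using C(1,3) sub(2) by (simp add: prec_iff double_diff)
      then have "?disj A2 C"
        by (rule asymptotically_disjoint_induced_sym)
      moreover have "X = (X - C) \<union> C"
        using C(1) by blast
      ultimately show
        "\<exists>X1 X2. X1 \<subseteq> X \<and> X2 \<subseteq> X \<and> X = X1 \<union> X2 \<and> ?disj A1 X1 \<and> ?disj A2 X2"
        using C(1) Diff_subset by metis
    qed
  next
    assume normal: "asymptotically_normal X (induced_resemblance X \<E>)"
    show "coarsely_normal X \<E>"
      unfolding coarsely_normal_def
    proof (intro allI impI)
      fix A B assume sub: "A \<subseteq> X" "B \<subseteq> X" and "coarse_prec X \<E> A B"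
      then have "?disj A (X - B)"
        by (simp add: prec_iff)
      then have "\<exists>X1 X2. X1 \<subseteq> X \<and> X2 \<subseteq> X \<and> X = X1 \<union> X2 \<and>
          ?disj A X1 \<and> ?disj (X - B) X2"
        by (rule normal[unfolded asymptotically_normal_def, rule_format, OF sub(1) Diff_subset])
      then obtain X1 X2 where cover: "X1 \<subseteq> X" "X = X1 \<union> X2"
        and disj: "?disj A X1" "?disj (X - B) X2"
        by (elim exE conjE)
      have "coarse_prec X \<E> A (X - X1)"
        using disj(1) sub(1) cover(1) by (simp add: prec_iff double_diff)
      moreover have "?disj (X - X1) (X - B)"
        by (rule asymptotically_disjoint_mono[OF asymptotically_disjoint_induced_sym[OF disj(2)]])
          (use equalityD1[OF cover(2)] in auto)
      then have "coarse_prec X \<E> (X - X1) B"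
        by (simp add: prec_iff)
      ultimately show "\<exists>C. C \<subseteq> X \<and> coarse_prec X \<E> A C \<and> coarse_prec X \<E> C B"
        by blast
    qed
  qed
qed

end
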